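(* Let $\mu,\nu$ be probability distributions on $\{0,1\}^n$ and let $w$ be a real number. Let $f:\{0,1\}^n\times\{0,1\}^n\to\{0,1\}$ be any function with no monochromatic rectangle of weight greater than $w$ under the product distribution $\mu\times\nu$. Then any linear decision list computing $f$ must have size at least $1/\sqrt{w}$.
   Context: Define $\mathrm{sign}:\mathbb{R}\to\{0,1\}$ by $\mathrm{sign}(x)=1$ if $x>0$ and $\mathrm{sign}(x)=0$ if $x\le 0$. A function $f:\{0,1\}^N\to\{0,1\}$ is a linear threshold function (LTF) if there are real numbers $w_0,w_1,\dots,w_N$ with $f(x)=\mathrm{sign}(w_0+\sum_{i=1}^N w_ix_i)$ for all $x$. A linear decision list of size $k$ on $N$ variables is a sequence $(L_1,a_1),\dots,(L_k,a_k)$ where each $a_i\in\{0,1\}$, each $L_i$ is an LTF on $\{0,1\}^N$ (arbitrary real weights), and $L_k$ is the constant function $1$. It computes the function $f$ given by $f(x)=a_i$, where $i$ is the least index with $L_i(x)=1$. A function on $\{0,1\}^n\times\{0,1\}^n$ is regarded as a function of $N=2n$ Boolean variables. For $b\in\{0,1\}$, a monochromatic $b$-rectangle of $f$ is a pair $(X,Y)$ with $X,Y\subseteq\{0,1\}^n$ and $f(x,y)=b$ for all $(x,y)\in X\times Y$; a monochromatic rectangle is a monochromatic $0$-rectangle or $1$-rectangle. For $X\subseteq\{0,1\}^n$, $\mu(X)=\sum_{x\in X}\mu(x)$. The weight of $(X,Y)$ under $\mu\times\nu$ is $\mu(X)\cdot\nu(Y)$. (Since some single point has positive weight, the hypothesis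 forces $w>0$.) *)

theory Defs
  imports "HOL-Probability.Probability_Mass_Function"
begin

(* The alphabet {0,1} is bool, with 1 = True; where a bit enters an arithmetic expression it is
   converted by of_bool. *)

definition cube :: "nat \<Rightarrow> bool list set" where
  "cube N = {x. length x = N}"

(* Not the library's sgn, which is {-1,0,1}-valued. *)
definition sign01 :: "real \<Rightarrow> bool" where
  "sign01 t \<longleftrightarrow> t > 0"

(* Only the values of g on the cube matter. *)
definition is_LTF :: "nat \<Rightarrow> (bool list \<Rightarrow> bool) \<Rightarrow> bool" where
  "is_LTF N g \<longleftrightarrow>
     (\<exists>(w0 :: real) (w :: nat \<Rightarrow> real).
        \<forall>x\<in>cube N. g x = sign01 (w0 + (\<Sum>i<N. w i * of_bool (x ! i))))"

type_synonym decision_list = "((bool list \<Rightarrow> bool) \<times> bool) list"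

(* The size is the length of the list. *)
definition linear_decision_list :: "nat \<Rightarrow> decision_list \<Rightarrow> bool" where
  "linear_decision_list N D \<longleftrightarrow>
     D \<noteq> [] \<and> (\<forall>(L, a)\<in>set D. is_LTF N L) \<and> (\<forall>x\<in>cube N. fst (last D) x)"

(* For a linear decision list on N variables and x in cube N the least index exists, because the
   last test is constantly 1. *)
definition dl_value :: "decision_list \<Rightarrow> bool list \<Rightarrow> bool" where
  "dl_value D x = snd (D ! (LEAST i. i < length D \<and> fst (D ! i) x))"

(* A pair (x, y) of n-bit strings is the assignment x @ y to 2 * n variables. *)
definition dl_computes :: "nat \<Rightarrow> decision_list \<Rightarrow> (bool list \<times> bool list \<Rightarrow> bool) \<Rightarrow> bool" where
  "dl_computes n D f \<longleftrightarrow> (\<forall>x\<in>cube n. \<forall>y\<in>cube n. dl_value D (x @ y) = f (x, y))"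

definition mono_rectangle_of ::
  "nat \<Rightarrow> (bool list \<times> bool list \<Rightarrow> bool) \<Rightarrow> bool \<Rightarrow> bool list set \<Rightarrow> bool list set \<Rightarrow> bool" where
  "mono_rectangle_of n f b X Y \<longleftrightarrow>
     X \<subseteq> cube n \<and> Y \<subseteq> cube n \<and> (\<forall>x\<in>X. \<forall>y\<in>Y. f (x, y) = b)"

definition mono_rectangle ::
  "nat \<Rightarrow> (bool list \<times> bool list \<Rightarrow> bool) \<Rightarrow> bool list set \<Rightarrow> bool list set \<Rightarrow> bool" where
  "mono_rectangle n f X Y \<longleftrightarrow> (\<exists>b. mono_rectangle_of n f b X Y)"

definition rectangle_weight ::
  "bool list pmf \<Rightarrow> bool list pmf \<Rightarrow> bool list set \<Rightarrow> bool list set \<Rightarrow> real" where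
  "rectangle_weight \<mu> \<nu> X Y = measure_pmf.prob \<mu> X * measure_pmf.prob \<nu> Y"

end

theory Submission
  imports Defs
begin

text \<open>
  Let \<open>k\<close> be the size of the list. On a rectangle an LTF has the form \<open>\<alpha> x + \<beta> y > 0\<close>. Cut the rows
  at the value of \<open>\<alpha>\<close> above which they have mass about \<open>1/k\<close>, and the columns likewise at a value of
  \<open>\<beta>\<close>. If the two cut values have positive sum, then the top rows and top columns form a rectangle
  with both sides of mass at least \<open>1/k\<close> on which the first test fires. Otherwise the first test is
  constantly \<open>0\<close> on the rows and columns up to the cut, and passing to them loses less than \<open>1/k\<close> of
  the mass on each side, so the remaining tests can be treated in the same way.
\<close>

lemma finite_cube: "finite (cube n)"
  using finite_lists_length_eq[of "UNIV :: bool set" n] by (simp add: cube_def)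

text \<open>The weighted sum splits at index \<open>m\<close>; the constant \<open>w0\<close> is
  absorbed into \<alpha>.\<close>

lemma is_LTF_append:
  assumes "is_LTF (m + n) L"
  shows "\<exists>\<alpha> \<beta> :: bool list \<Rightarrow> real.
    \<forall>x\<in>cube m. \<forall>y\<in>cube n. L (x @ y) \<longleftrightarrow> \<alpha> x + \<beta> y > 0"
proof -
  obtain w0 :: real and w :: "nat \<Rightarrow> real"
    where w: "\<And>z. z \<in> cube (m + n) \<Longrightarrow> L z = sign01 (w0 + (\<Sum>i<m + n. w i * of_bool (z ! i)))"
    using assms by (auto simp: is_LTF_def)
  have "L (x @ y) \<longleftrightarrow>
      (w0 + (\<Sum>i<m. w i * of_bool (x ! i))) + (\<Sum>i<n. w (m + i) * of_bool (y ! i)) > 0"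
    if "x \<in> cube m" "y \<in> cube n" for x y
  proof -
    have "(\<Sum>i<m + n. w i * of_bool ((x @ y) ! i)) =
        (\<Sum>i<m. w i * of_bool ((x @ y) ! i)) + (\<Sum>i<n. w (m + i) * of_bool ((x @ y) ! (m + i)))"
      by (induction n) (simp_all add: algebra_simps)
    also have "\<dots> = (\<Sum>i<m. w i * of_bool (x ! i)) + (\<Sum>i<n. w (m + i) * of_bool (y ! i))"
      using that by (simp add: cube_def nth_append)
    finally show ?thesis
      using w[of "x @ y"] that by (simp add: cube_def sign01_def algebra_simps)
  qed
  then show ?thesis by (intro exI ballI)
qed

text \<open>The assumption guarantees that some test fires, so that \<open>LEAST\<close> is
  meaningful. If the head does not fire, the least index is the successor of the one in the
  tail.\<close>

lemma dl_value_Cons: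
  assumes "fst d z \<or> (\<exists>e\<in>set D. fst e z)"
  shows "dl_value (d # D) z = (if fst d z then snd d else dl_value D z)"
proof (cases "fst d z")
  case True
  then have "(LEAST i. i < length (d # D) \<and> fst ((d # D) ! i) z) = 0"
    by (intro Least_eq_0) simp
  with True show ?thesis by (simp add: dl_value_def)
next
  case False
  with assms obtain i where "i < length D" "fst (D ! i) z"
    by (auto simp: in_set_conv_nth)
  then have "(LEAST i. i < length (d # D) \<and> fst ((d # D) ! i) z) =
      Suc (LEAST i. Suc i < length (d # D) \<and> fst ((d # D) ! Suc i) z)"
    using False by (intro Least_Suc[of _ "Suc i"]) simp_all
  with False show ?thesis by (simp add: dl_value_def)
qed

text \<open>Take the largest value of \<alpha> on \<open>X\<close> whose closed upper part still has
  mass \<delta>. The value \<open>t\<close> may itself carry much mass, hence two bounds: the closed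
  part will be a side of a rectangle, the open part is what gets discarded.\<close>

lemma upper_quantile_exists:
  fixes \<alpha> :: "'a \<Rightarrow> real"
  assumes "finite X" "0 < \<delta>" "\<delta> \<le> measure_pmf.prob p X"
  obtains t where "\<delta> \<le> measure_pmf.prob p {x \<in> X. t \<le> \<alpha> x}"
    and "measure_pmf.prob p {x \<in> X. t < \<alpha> x} < \<delta>"
proof -
  let ?P = "\<lambda>t. \<delta> \<le> measure_pmf.prob p {x \<in> X. t \<le> \<alpha> x}"
  define S where "S = {t \<in> \<alpha> ` X. ?P t}"
  have fin: "finite S" using assms(1) by (simp add: S_def)
  have "X \<noteq> {}" using assms by auto
  then have "Min (\<alpha> ` X) \<in> \<alpha> ` X" using assms(1) by (intro Min_in) auto
  moreover have "{x \<in> X. Min (\<alpha> ` X) \<le> \<alpha> x} = X" using assms(1) by auto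
  ultimately have "Min (\<alpha> ` X) \<in> \<alpha> ` X \<and> ?P (Min (\<alpha> ` X))" using assms(3) by metis
  then have "Min (\<alpha> ` X) \<in> S" unfolding S_def by (rule CollectI)
  then have "S \<noteq> {}" by blast
  define t where "t = Max S"
  have "t \<in> S" using fin \<open>S \<noteq> {}\<close> by (simp add: t_def)
  have "measure_pmf.prob p {x \<in> X. t < \<alpha> x} < \<delta>"
  proof (cases "{x \<in> X. t < \<alpha> x} = {}")
    case True
    then show ?thesis using \<open>0 < \<delta>\<close> by (simp only: measure_empty)
  next
    case False
    \<comment> \<open>\<open>s\<close> is the next value of \<alpha> after \<open>t\<close>: the
      open part above \<open>t\<close> is the closed part from \<open>s\<close> on, and
      \<open>s\<close> fails the mass bound because \<open>t\<close> is maximal.\<close>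
    define s where "s = Min (\<alpha> ` {x \<in> X. t < \<alpha> x})"
    have "s \<in> \<alpha> ` {x \<in> X. t < \<alpha> x}"
      unfolding s_def using False assms(1) by (intro Min_in) auto
    moreover have "s \<le> \<alpha> x" if "x \<in> X" "t < \<alpha> x" for x
      unfolding s_def using that assms(1) by (intro Min_le) auto
    ultimately have s: "s \<in> \<alpha> ` X" "t < s" "{x \<in> X. t < \<alpha> x} = {x \<in> X. s \<le> \<alpha> x}"
      by fastforce+
    have "s \<notin> S" using Max_ge[OF fin, of s] s(2) by (auto simp: t_def)
    then show ?thesis using s by (simp add: S_def)
  qed
  with \<open>t \<in> S\<close> show thesis by (intro that[of t]) (simp_all add: S_def)
qed

lemma prob_lower_part:
  fixes \<alpha> :: "'a \<Rightarrow> real"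
  shows "measure_pmf.prob p X =
    measure_pmf.prob p {x \<in> X. \<alpha> x \<le> t} + measure_pmf.prob p {x \<in> X. t < \<alpha> x}"
proof -
  have "X = {x \<in> X. \<alpha> x \<le> t} \<union> {x \<in> X. t < \<alpha> x}" by auto
  then show ?thesis
    by (metis (no_types, lifting) disjoint_iff leD mem_Collect_eq
        measure_pmf.finite_measure_Union sets_measure_pmf UNIV_I)
qed

text \<open>Stated for arbitrary \<open>X\<close> and \<open>Y\<close> so that the induction can
  pass to smaller rectangles. Each test costs less than \<delta> of mass per side, so a budget of
  \<delta> per test leaves \<delta> for the last one, which always fires.\<close>

lemma decision_list_rectangle:
  assumes "D \<noteq> []" "0 < \<delta>"
    and "\<forall>(L, a)\<in>set D. is_LTF (m + n) L" "\<forall>z\<in>cube (m + n). fst (last D) z"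
    and "X \<subseteq> cube m" "Y \<subseteq> cube n"
    and "real (length D) * \<delta> \<le> measure_pmf.prob \<mu> X"
    and "real (length D) * \<delta> \<le> measure_pmf.prob \<nu> Y"
  shows "\<exists>X'\<subseteq>X. \<exists>Y'\<subseteq>Y. \<exists>b. \<delta> \<le> measure_pmf.prob \<mu> X' \<and> \<delta> \<le> measure_pmf.prob \<nu> Y' \<and>
    (\<forall>x\<in>X'. \<forall>y\<in>Y'. dl_value D (x @ y) = b)"
  using assms
proof (induction D arbitrary: X Y rule: list_nonempty_induct)
  case (single d)
  have app: "x @ y \<in> cube (m + n)" if "x \<in> X" "y \<in> Y" for x y
    using that single.prems(4,5) by (auto simp: cube_def)
  have "dl_value [d] (x @ y) = snd d" if "x \<in> X" "y \<in> Y" for x y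
    using app[OF that] single.prems(3) by (simp add: dl_value_Cons)
  then show ?case using single.prems(6,7) by (intro exI[of _ X] exI[of _ Y]) auto
next
  case (cons d D)
  have app: "x @ y \<in> cube (m + n)" if "x \<in> X" "y \<in> Y" for x y
    using that cons.prems(4,5) by (auto simp: cube_def)
  have val: "dl_value (d # D) (x @ y) = (if fst d (x @ y) then snd d else dl_value D (x @ y))"
    if "x \<in> X" "y \<in> Y" for x y
    using app[OF that] cons.prems(3) cons.hyps by (intro dl_value_Cons) (auto intro: last_in_set)
  have "is_LTF (m + n) (fst d)" using cons.prems(2) by (auto split: prod.splits)
  from is_LTF_append[OF this] obtain \<alpha> \<beta> :: "bool list \<Rightarrow> real"
    where "\<forall>x\<in>cube m. \<forall>y\<in>cube n. fst d (x @ y) \<longleftrightarrow> \<alpha> x + \<beta> y > 0"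
    by (elim exE)
  then have sep: "\<And>x y. x \<in> X \<Longrightarrow> y \<in> Y \<Longrightarrow> fst d (x @ y) \<longleftrightarrow> \<alpha> x + \<beta> y > 0"
    using cons.prems(4,5) by blast
  have fin: "finite X" "finite Y"
    using cons.prems(4,5) finite_cube finite_subset by blast+
  have "\<delta> \<le> real (length (d # D)) * \<delta>" using cons.prems(1) by simp
  then have \<delta>: "\<delta> \<le> measure_pmf.prob \<mu> X" "\<delta> \<le> measure_pmf.prob \<nu> Y"
    using cons.prems(6,7) by linarith+
  obtain s where s: "\<delta> \<le> measure_pmf.prob \<mu> {x \<in> X. s \<le> \<alpha> x}"
    "measure_pmf.prob \<mu> {x \<in> X. s < \<alpha> x} < \<delta>"
    using upper_quantile_exists[OF fin(1) cons.prems(1) \<delta>(1)] .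
  obtain t where t: "\<delta> \<le> measure_pmf.prob \<nu> {y \<in> Y. t \<le> \<beta> y}"
    "measure_pmf.prob \<nu> {y \<in> Y. t < \<beta> y} < \<delta>"
    using upper_quantile_exists[OF fin(2) cons.prems(1) \<delta>(2)] .
  show ?case
  proof (cases "s + t > 0")
    case True
    \<comment> \<open>Here \<alpha> x + \<beta> y \<ge> s + t > 0, so the head decides.\<close>
    then have "dl_value (d # D) (x @ y) = snd d" if "x \<in> X" "s \<le> \<alpha> x" "y \<in> Y" "t \<le> \<beta> y" for x y
      using that val sep by auto
    with s(1) t(1) show ?thesis
      by (intro exI[of _ "{x \<in> X. s \<le> \<alpha> x}"] exI[of _ "{y \<in> Y. t \<le> \<beta> y}"] exI[of _ "snd d"] conjI)
        simp_all
  next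
    case False
    \<comment> \<open>Points at the cut values are kept, so only the open upper parts, of mass below
      \<delta>, are lost.\<close>
    let ?X = "{x \<in> X. \<alpha> x \<le> s}" and ?Y = "{y \<in> Y. \<beta> y \<le> t}"
    have "real (length D) * \<delta> \<le> measure_pmf.prob \<mu> ?X"
      using prob_lower_part[of \<mu> X \<alpha> s] s(2) cons.prems(6) by (simp add: algebra_simps)
    moreover have "real (length D) * \<delta> \<le> measure_pmf.prob \<nu> ?Y"
      using prob_lower_part[of \<nu> Y \<beta> t] t(2) cons.prems(7) by (simp add: algebra_simps)
    moreover have "\<forall>(L, a)\<in>set D. is_LTF (m + n) L" "\<forall>z\<in>cube (m + n). fst (last D) z"
      using cons.prems(2,3) cons.hyps by auto
    moreover have "?X \<subseteq> cube m" "?Y \<subseteq> cube n" using cons.prems(4,5) by auto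
    ultimately have "\<exists>X'\<subseteq>?X. \<exists>Y'\<subseteq>?Y. \<exists>b. \<delta> \<le> measure_pmf.prob \<mu> X' \<and> \<delta> \<le> measure_pmf.prob \<nu> Y' \<and>
        (\<forall>x\<in>X'. \<forall>y\<in>Y'. dl_value D (x @ y) = b)"
      by (intro cons.IH cons.prems(1))
    then obtain X' Y' b where sub: "X' \<subseteq> ?X" "Y' \<subseteq> ?Y"
      and big: "\<delta> \<le> measure_pmf.prob \<mu> X'" "\<delta> \<le> measure_pmf.prob \<nu> Y'"
      and b: "\<forall>x\<in>X'. \<forall>y\<in>Y'. dl_value D (x @ y) = b"
      by (elim exE conjE)
    have "dl_value (d # D) (x @ y) = b" if "x \<in> X'" "y \<in> Y'" for x y
    proof -
      have xy: "x \<in> X" "y \<in> Y" "\<alpha> x \<le> s" "\<beta> y \<le> t" using that sub by auto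
      \<comment> \<open>Now \<alpha> x + \<beta> y \<le> s + t \<le> 0, and the value is left to
        \<open>D\<close>.\<close>
      then have "\<not> fst d (x @ y)" using False sep by auto
      then show ?thesis using val xy b that by simp
    qed
    moreover have "X' \<subseteq> X" "Y' \<subseteq> Y" using sub by auto
    ultimately show ?thesis using big
      by (intro exI[of _ X'] exI[of _ Y'] exI[of _ b] conjI) simp_all
  qed
qed

theorem lemma17:
  fixes n :: nat
    and \<mu> \<nu> :: "bool list pmf"
    and w :: real
    and f :: "bool list \<times> bool list \<Rightarrow> bool"
    and D :: decision_list
  assumes "set_pmf \<mu> \<subseteq> cube n"
    and "set_pmf \<nu> \<subseteq> cube n"
    and "\<not> (\<exists>X Y. mono_rectangle n f X Y \<and> rectangle_weight \<mu> \<nu> X Y > w)"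
    and "linear_decision_list (2 * n) D"
    and "dl_computes n D f"
  shows "real (length D) \<ge> 1 / sqrt w"
proof -
  define k where "k = real (length D)"
  have D: "D \<noteq> []" "\<forall>(L, a)\<in>set D. is_LTF (n + n) L" "\<forall>z\<in>cube (n + n). fst (last D) z"
    using assms(4) by (simp_all add: linear_decision_list_def mult_2)
  then have "k > 0" by (simp add: k_def)
  have full: "measure_pmf.prob \<mu> (cube n) = 1" "measure_pmf.prob \<nu> (cube n) = 1"
    using assms(1,2) by (auto simp: measure_pmf.prob_eq_1 AE_measure_pmf_iff)
  \<comment> \<open>With \<delta> = 1 / k the budget \<open>k * \<delta>\<close> is 1, exactly the
    mass of the whole cube.\<close>
  obtain X Y b where sub: "X \<subseteq> cube n" "Y \<subseteq> cube n"
    and big: "1 / k \<le> measure_pmf.prob \<mu> X" "1 / k \<le> measure_pmf.prob \<nu> Y"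
    and b: "\<forall>x\<in>X. \<forall>y\<in>Y. dl_value D (x @ y) = b"
    using decision_list_rectangle[OF D(1) _ D(2,3), of "1 / k" "cube n" "cube n" \<mu> \<nu>] \<open>k > 0\<close> full
    by (auto simp: k_def)
  have "\<forall>x\<in>X. \<forall>y\<in>Y. f (x, y) = b"
    using assms(5) b sub unfolding dl_computes_def by blast
  then have "mono_rectangle n f X Y"
    using sub by (auto simp: mono_rectangle_def mono_rectangle_of_def)
  then have "rectangle_weight \<mu> \<nu> X Y \<le> w" using assms(3) by (meson not_le)
  moreover have "(1 / k) * (1 / k) \<le> rectangle_weight \<mu> \<nu> X Y"
    unfolding rectangle_weight_def using big \<open>k > 0\<close> by (intro mult_mono) auto
  ultimately have "(1 / k)\<^sup>2 \<le> w" by (simp add: power2_eq_square)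
  then have "1 / k \<le> sqrt w" by (rule real_le_rsqrt)
  moreover have "0 < 1 / k" using \<open>k > 0\<close> by simp
  \<comment> \<open>The sign of \<open>w\<close> is not given; positivity of \<open>sqrt w\<close>
    is derived here to permit dividing by it.\<close>
  ultimately have "0 < sqrt w" by linarith
  moreover have "1 \<le> k * sqrt w"
    using \<open>1 / k \<le> sqrt w\<close> \<open>k > 0\<close> by (simp add: divide_le_eq mult.commute)
  ultimately show ?thesis by (simp add: k_def divide_le_eq)
qed

end
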